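(* Let $G$ be a finite simple graph on the vertex set $[n]$ without isolated vertices, let $K$ be a field and $S=K[x_1,\dots,x_n]$. The following conditions are equivalent: (a) $I(G)$ is matroidal; (b) $I_c(G)$ is matroidal; (c) $G^c$ is a $P_3$-free graph; (d) $G^c$ is a disjoint union of cliques; (e) $G$ is a complete multipartite graph.
   Context: $[n]=\{1,\dots,n\}$; $G$ has vertex set $[n]$ and edge set $E(G)$. The edge ideal of $G$ is $I(G)=(x_ix_j:\{i,j\}\in E(G))\subset S$, and the complementary edge ideal of $G$ is $I_c(G)=\big((x_1\cdots x_n)/(x_ix_j) : \{i,j\}\in E(G)\big)\subset S$. For a monomial ideal $I$, $\mathcal{G}(I)$ is its minimal set of monomial generators, and for a monomial $u$, $\deg_{x_i}(u)=\max\{j : x_i^j \text{ divides } u\}$. A monomial ideal $I$ is polymatroidal if all monomials in $\mathcal{G}(I)$ have the same degree and for all $u,v\in\mathcal{G}(I)$ and all $i$ with $\deg_{x_i}(u)>\deg_{x_i}(v)$ there exists $j$ with $\deg_{x_j}(u)<\deg_{x_j}(v)$ such that $x_j(u/x_i)\in\mathcal{G}(I)$. A matroidal ideal is a squarefree polymatroidal ideal. $G^c$ is the complementary graph (same vertex set, edges exactly the pairs $\{i,j\}$, $i\neq j$, not in $E(G)$). A graph is $P_3$-free if it contains no induced subgraph isomorphic to the path $P_3$ on three vertices. $G$ is complete multipartite if there is a partition $V(G)=A_1\sqcup\cdots\sqcup A_m$ with $m\ge2$ and all $A_i\neq\emptyset$ such that $E(G)=\{\{r,s\} : r\in A_i,\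 s\in A_j,\ i\ne j\}$. *)

theory Defs
  imports
    "HOL-Algebra.Ideal"
    "HOL-Library.Poly_Mapping"
    "HOL-Library.Disjoint_Sets"
    "HOL-Library.Ramsey"
begin

section \<open>The polynomial ring and its monomials\<close>

text \<open>Monomials are exponent vectors: multiplication of monomials is addition of vectors,
  \<open>Poly_Mapping.single i 1\<close> is the variable \<open>x\<^sub>i\<close>. A polynomial maps monomials to coefficients
  and its multiplication is the convolution product of \<^theory>\<open>HOL-Library.Poly_Mapping\<close>.\<close>

type_synonym mono = "nat \<Rightarrow>\<^sub>0 nat"

type_synonym 'k mpoly = "mono \<Rightarrow>\<^sub>0 'k"

definition monomials :: "nat \<Rightarrow> mono set"
  where "monomials n = {u. Poly_Mapping.keys u \<subseteq> {1..n}}"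

text \<open>\<open>S = K[x\<^sub>1,\<dots>,x\<^sub>n]\<close>, as a subring of the polynomials in the variables \<open>x\<^sub>i\<close> with \<open>i :: nat\<close>.\<close>

definition poly_ring :: "nat \<Rightarrow> 'k::field mpoly ring"
  where "poly_ring n =
    \<lparr>carrier = {p. Poly_Mapping.keys p \<subseteq> monomials n}, mult = (*), one = 1, zero = 0, add = (+)\<rparr>"

definition mono_poly :: "mono \<Rightarrow> 'k::field mpoly"
  where "mono_poly u = Poly_Mapping.single u 1"

lemma monomials_add: "u \<in> monomials n \<Longrightarrow> v \<in> monomials n \<Longrightarrow> u + v \<in> monomials n"
  using Poly_Mapping.keys_add[of u v] by (auto simp: monomials_def)

lemma zero_in_monomials: "0 \<in> monomials n"
  by (simp add: monomials_def)

lemma cring_poly_ring: "cring (poly_ring n :: 'k::field mpoly ring)"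
proof (rule cringI)
  show "abelian_group (poly_ring n :: 'k mpoly ring)"
  proof (rule abelian_groupI)
    fix p :: "'k mpoly"
    assume "p \<in> carrier (poly_ring n)"
    then have "- p \<in> carrier (poly_ring n)" "- p \<oplus>\<^bsub>poly_ring n\<^esub> p = \<zero>\<^bsub>poly_ring n\<^esub>"
      by (auto simp: poly_ring_def in_keys_iff)
    then show "\<exists>q\<in>carrier (poly_ring n). q \<oplus>\<^bsub>poly_ring n\<^esub> p = \<zero>\<^bsub>poly_ring n\<^esub>"
      by blast
  qed (use Poly_Mapping.keys_add in \<open>fastforce simp: poly_ring_def add_ac\<close>)+
  show "comm_monoid (poly_ring n :: 'k mpoly ring)"
  proof (rule comm_monoidI)
    fix p q :: "'k mpoly"
    assume "p \<in> carrier (poly_ring n)" "q \<in> carrier (poly_ring n)"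
    then show "p \<otimes>\<^bsub>poly_ring n\<^esub> q \<in> carrier (poly_ring n)"
      using keys_mult[of p q] by (fastforce simp: poly_ring_def intro: monomials_add)
  qed (auto simp: poly_ring_def mult_ac zero_in_monomials)
qed (auto simp: poly_ring_def distrib_right)

section \<open>Monomial ideals and matroidal ideals\<close>

definition mono_dvd :: "mono \<Rightarrow> mono \<Rightarrow> bool"
  where "mono_dvd u v \<longleftrightarrow> (\<exists>w. v = u + w)"

text \<open>\<open>Poly_Mapping.single i j\<close> is the monomial \<open>x\<^sub>i\<^sup>j\<close>.\<close>

definition deg_var :: "nat \<Rightarrow> mono \<Rightarrow> nat"
  where "deg_var i u = Max {j. mono_dvd (Poly_Mapping.single i j) u}"

lemma deg_var_eq_lookup: "deg_var i u = Poly_Mapping.lookup u i"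
proof -
  have "mono_dvd (Poly_Mapping.single i j) u \<longleftrightarrow> j \<le> Poly_Mapping.lookup u i" for j
  proof
    assume "mono_dvd (Poly_Mapping.single i j) u"
    then show "j \<le> Poly_Mapping.lookup u i"
      by (auto simp: mono_dvd_def lookup_add)
  next
    assume "j \<le> Poly_Mapping.lookup u i"
    then have "u = Poly_Mapping.single i j + (u - Poly_Mapping.single i j)"
      by (intro poly_mapping_eqI) (auto simp: lookup_add lookup_minus lookup_single when_def)
    then show "mono_dvd (Poly_Mapping.single i j) u"
      unfolding mono_dvd_def by blast
  qed
  then have "{j. mono_dvd (Poly_Mapping.single i j) u} = {..Poly_Mapping.lookup u i}"
    by auto
  then show ?thesis
    by (auto simp: deg_var_def intro!: Max_eqI)
qed

definition mono_degree :: "mono \<Rightarrow> nat"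
  where "mono_degree u = (\<Sum>i\<in>Poly_Mapping.keys u. Poly_Mapping.lookup u i)"

definition mono_gen_ideal :: "nat \<Rightarrow> mono set \<Rightarrow> 'k::field mpoly set"
  where "mono_gen_ideal n M = Idl\<^bsub>poly_ring n\<^esub> (mono_poly ` M)"

definition monomial_ideal :: "nat \<Rightarrow> 'k::field mpoly set \<Rightarrow> bool"
  where "monomial_ideal n I \<longleftrightarrow> (\<exists>M\<subseteq>monomials n. I = mono_gen_ideal n M)"

definition is_min_gens :: "nat \<Rightarrow> 'k::field mpoly set \<Rightarrow> mono set \<Rightarrow> bool"
  where "is_min_gens n I M \<longleftrightarrow>
    M \<subseteq> monomials n \<and> mono_gen_ideal n M = I \<and> (\<forall>M'. M' \<subset> M \<longrightarrow> mono_gen_ideal n M' \<noteq> I)"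

text \<open>The set \<open>\<G>(I)\<close>. A monomial ideal has exactly one minimal set of monomial generators;
  for other ideals the value is irrelevant.\<close>

definition min_gens :: "nat \<Rightarrow> 'k::field mpoly set \<Rightarrow> mono set"
  where "min_gens n I = (THE M. is_min_gens n I M)"

text \<open>The exponent vector in the last line is \<open>x\<^sub>j(u/x\<^sub>i)\<close>; the subtraction is not truncated, as
  \<open>x\<^sub>i\<close> divides \<open>u\<close>.\<close>

definition polymatroidal :: "nat \<Rightarrow> 'k::field mpoly set \<Rightarrow> bool"
  where "polymatroidal n I \<longleftrightarrow>
    monomial_ideal n I \<and>
    (\<forall>u\<in>min_gens n I. \<forall>v\<in>min_gens n I. mono_degree u = mono_degree v) \<and>
    (\<forall>u\<in>min_gens n I. \<forall>v\<in>min_gens n I. \<forall>i\<in>{1..n}. deg_var i u > deg_var i v \<longrightarrow>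
      (\<exists>j\<in>{1..n}. deg_var j u < deg_var j v \<and>
        Poly_Mapping.single j 1 + (u - Poly_Mapping.single i 1) \<in> min_gens n I))"

definition squarefree_ideal :: "nat \<Rightarrow> 'k::field mpoly set \<Rightarrow> bool"
  where "squarefree_ideal n I \<longleftrightarrow>
    monomial_ideal n I \<and> (\<forall>u\<in>min_gens n I. \<forall>i\<in>{1..n}. deg_var i u \<le> 1)"

definition matroidal :: "nat \<Rightarrow> 'k::field mpoly set \<Rightarrow> bool"
  where "matroidal n I \<longleftrightarrow> squarefree_ideal n I \<and> polymatroidal n I"

section \<open>Graphs\<close>

text \<open>A graph is given by its vertex set \<open>V\<close> and its set \<open>E\<close> of edges, which are two-element
  subsets of \<open>V\<close>; \<open>[V]\<^bsup>2\<^esup>\<close> is the set of all of these.\<close>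

definition simple_graph :: "'a set \<Rightarrow> 'a set set \<Rightarrow> bool"
  where "simple_graph V E \<longleftrightarrow> finite V \<and> E \<subseteq> [V]\<^bsup>2\<^esup>"

definition no_isolated :: "'a set \<Rightarrow> 'a set set \<Rightarrow> bool"
  where "no_isolated V E \<longleftrightarrow> (\<forall>v\<in>V. \<exists>e\<in>E. v \<in> e)"

definition compl_edges :: "'a set \<Rightarrow> 'a set set \<Rightarrow> 'a set set"
  where "compl_edges V E = [V]\<^bsup>2\<^esup> - E"

definition induced_edges :: "'a set set \<Rightarrow> 'a set \<Rightarrow> 'a set set"
  where "induced_edges E W = {e \<in> E. e \<subseteq> W}"

definition graph_isomorphic :: "'a set \<Rightarrow> 'a set set \<Rightarrow> 'b set \<Rightarrow> 'b set set \<Rightarrow> bool"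
  where "graph_isomorphic V E V' E' \<longleftrightarrow> (\<exists>f. bij_betw f V V' \<and> E' = (\<lambda>e. f ` e) ` E)"

definition P3_verts :: "nat set"
  where "P3_verts = {1, 2, 3}"

definition P3_edges :: "nat set set"
  where "P3_edges = {{1, 2}, {2, 3}}"

definition P3_free :: "'a set \<Rightarrow> 'a set set \<Rightarrow> bool"
  where "P3_free V E \<longleftrightarrow>
    \<not> (\<exists>W\<subseteq>V. graph_isomorphic P3_verts P3_edges W (induced_edges E W))"

definition disjoint_union_of_cliques :: "'a set \<Rightarrow> 'a set set \<Rightarrow> bool"
  where "disjoint_union_of_cliques V E \<longleftrightarrow>
    (\<exists>P. partition_on V P \<and> E = (\<Union>A\<in>P. [A]\<^bsup>2\<^esup>))"

definition complete_multipartite :: "'a set \<Rightarrow> 'a set set \<Rightarrow> bool"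
  where "complete_multipartite V E \<longleftrightarrow>
    (\<exists>(m::nat) A. m \<ge> 2 \<and> V = (\<Union>i\<in>{1..m}. A i) \<and> disjoint_family_on A {1..m} \<and>
      (\<forall>i\<in>{1..m}. A i \<noteq> {}) \<and>
      E = {{r, s} | r s i j. i \<in> {1..m} \<and> j \<in> {1..m} \<and> i \<noteq> j \<and> r \<in> A i \<and> s \<in> A j})"

section \<open>Edge ideals\<close>

definition edge_ideal :: "nat \<Rightarrow> nat set set \<Rightarrow> 'k::field mpoly set"
  where "edge_ideal n E =
    mono_gen_ideal n {Poly_Mapping.single i 1 + Poly_Mapping.single j 1 | i j. {i, j} \<in> E}"

text \<open>The generators are \<open>(x\<^sub>1\<cdots>x\<^sub>n)/(x\<^sub>ix\<^sub>j)\<close>; the subtraction is not truncated, as an edge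
  consists of two distinct \<open>i, j \<in> {1..n}\<close>.\<close>

definition compl_edge_ideal :: "nat \<Rightarrow> nat set set \<Rightarrow> 'k::field mpoly set"
  where "compl_edge_ideal n E =
    mono_gen_ideal n
      {(\<Sum>k\<in>{1..n}. Poly_Mapping.single k 1) - (Poly_Mapping.single i 1 + Poly_Mapping.single j 1)
        | i j. {i, j} \<in> E}"

end

theory Submission
  imports Defs
begin

text \<open>
  All five conditions say that non-adjacency is transitive: no vertex \<open>a\<close> is non-adjacent
  to both ends of an edge \<open>{b, c}\<close> avoiding it (\<open>transitive_nonadjacency\<close>).

  For the two algebraic conditions, a squarefree monomial is the same thing as a set of variables,
  and both ideals are generated by squarefree monomials of one fixed degree. Among monomials of one
  degree none properly divides another, so the given generators are the minimal ones
  (\<open>min_gens_antichain\<close>), and the ideal is matroidal exactly when the supports of the generators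
  satisfy the basis exchange axiom of matroids (\<open>matroidal_squarefree_iff\<close>). For \<open>I(G)\<close> the
  supports are the edges, for \<open>I\<^sub>c(G)\<close> their complements. In both cases the exchange axiom,
  applied to an edge \<open>{b, c}\<close> and an edge \<open>{a, i}\<close> through a further vertex \<open>a\<close>, yields the edge
  \<open>{a, b}\<close> or the edge \<open>{a, c}\<close>; the edge \<open>{a, i}\<close> exists because \<open>a\<close> is not isolated.
  Conversely, transitivity provides an edge from \<open>a\<close> to \<open>b\<close> or \<open>c\<close>, and that is the edge which
  the exchange axiom asks for; if the two given edges meet, one of them already is an answer.

  On the side of graphs, a triple \<open>a, b, c\<close> violating transitivity is an induced path with
  middle vertex \<open>a\<close> in the complementary graph. Without such triples, non-adjacency is
  an equivalence relation on the vertices; its classes are both the cliques of \<open>G\<^sup>c\<close> and the parts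
  of \<open>G\<close>.
\<close>

section \<open>Minimal generators of monomial ideals\<close>

lemma mono_dvd_refl: "mono_dvd u u"
  unfolding mono_dvd_def by (metis add.right_neutral)

lemma mono_dvd_trans: "mono_dvd u v \<Longrightarrow> mono_dvd v w \<Longrightarrow> mono_dvd u w"
  unfolding mono_dvd_def by (metis add.assoc)

lemma mono_dvd_lookup_le:
  "mono_dvd u v \<Longrightarrow> Poly_Mapping.lookup u i \<le> Poly_Mapping.lookup v i"
  by (auto simp: mono_dvd_def lookup_add)

lemma mono_dvd_antisym: "mono_dvd u v \<Longrightarrow> mono_dvd v u \<Longrightarrow> u = v"
  by (intro poly_mapping_eqI antisym mono_dvd_lookup_le)

lemma mono_dvd_add_right: "mono_dvd u v \<Longrightarrow> mono_dvd u (w + v)"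
  unfolding mono_dvd_def by (metis add.assoc add.commute)

lemma keys_mono_poly: "Poly_Mapping.keys (mono_poly u :: 'k::field mpoly) = {u}"
  by (simp add: mono_poly_def)

lemma a_inv_poly_ring:
  assumes "p \<in> carrier (poly_ring n :: 'k::field mpoly ring)"
  shows "\<ominus>\<^bsub>poly_ring n\<^esub> p = - p"
proof -
  interpret cring "poly_ring n :: 'k mpoly ring" by (rule cring_poly_ring)
  from assms have "- p \<in> carrier (poly_ring n)"
    by (auto simp: poly_ring_def in_keys_iff)
  then show ?thesis
    using assms by (intro minus_equality) (auto simp: poly_ring_def)
qed

lemma ideal_divisible_polys:
  "ideal {p. Poly_Mapping.keys p \<subseteq> {u \<in> monomials n. \<exists>m\<in>M. mono_dvd m u}}
     (poly_ring n :: 'k::field mpoly ring)" (is "ideal ?J ?R")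
proof -
  interpret cring ?R by (rule cring_poly_ring)
  have carrier: "p \<in> carrier ?R" if "p \<in> ?J" for p
    using that by (auto simp: poly_ring_def)
  have l_closed: "x * p \<in> ?J" if "p \<in> ?J" "x \<in> carrier ?R" for p x
    using that keys_mult[of x p]
    by (fastforce simp: poly_ring_def intro: monomials_add mono_dvd_add_right)
  show ?thesis
  proof (rule idealI)
    show "ring ?R" by (rule ring_axioms)
    show "subgroup ?J (add_monoid ?R)"
    proof (rule add.subgroupI)
      show "?J \<subseteq> carrier ?R" using carrier by blast
      have "0 \<in> ?J" by simp
      then show "?J \<noteq> {}" by blast
    next
      fix p assume p: "p \<in> ?J"
      then have "- p \<in> ?J" by (auto simp: in_keys_iff)
      then show "\<ominus>\<^bsub>?R\<^esub> p \<in> ?J"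
        using a_inv_poly_ring[OF carrier[OF p]] by simp
    next
      fix p q assume "p \<in> ?J" "q \<in> ?J"
      then show "p \<oplus>\<^bsub>?R\<^esub> q \<in> ?J"
        using Poly_Mapping.keys_add[of p q] by (fastforce simp: poly_ring_def)
    qed
  next
    fix p x assume "p \<in> ?J" "x \<in> carrier ?R"
    then have "x * p \<in> ?J" by (rule l_closed)
    then show "x \<otimes>\<^bsub>?R\<^esub> p \<in> ?J" "p \<otimes>\<^bsub>?R\<^esub> x \<in> ?J"
      by (simp_all add: poly_ring_def mult.commute)
  qed
qed

lemma mono_poly_in_mono_gen_ideal:
  assumes "M \<subseteq> monomials n" "u \<in> M"
  shows "mono_poly u \<in> (mono_gen_ideal n M :: 'k::field mpoly set)"
proof -
  interpret cring "poly_ring n :: 'k mpoly ring" by (rule cring_poly_ring)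
  have "mono_poly ` M \<subseteq> carrier (poly_ring n :: 'k mpoly ring)"
    using assms by (auto simp: poly_ring_def keys_mono_poly)
  from genideal_self[OF this] show ?thesis
    using assms by (auto simp: mono_gen_ideal_def)
qed

text \<open>The polynomials whose terms are all divisible by elements of \<open>M\<close> form an ideal that contains
  \<open>M\<close>, hence also the ideal that \<open>M\<close> generates.\<close>

lemma mono_gen_ideal_divisible:
  assumes "M \<subseteq> monomials n"
    and "mono_poly u \<in> (mono_gen_ideal n M :: 'k::field mpoly set)"
  shows "\<exists>m\<in>M. mono_dvd m u"
proof -
  interpret cring "poly_ring n :: 'k mpoly ring" by (rule cring_poly_ring)
  let ?J = "{p :: 'k mpoly. Poly_Mapping.keys p \<subseteq> {u \<in> monomials n. \<exists>m\<in>M. mono_dvd m u}}"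
  have "mono_poly ` M \<subseteq> ?J"
    using assms(1) by (auto simp: keys_mono_poly intro: mono_dvd_refl)
  then have "mono_gen_ideal n M \<subseteq> ?J"
    unfolding mono_gen_ideal_def by (intro genideal_minimal ideal_divisible_polys)
  then show ?thesis
    using assms(2) by (auto simp: keys_mono_poly)
qed

text \<open>If \<open>N\<close> generates the same ideal as the antichain \<open>M\<close>, then each \<open>m \<in> M\<close> is divisible by
  some \<open>v \<in> N\<close> and that \<open>v\<close> by some \<open>m' \<in> M\<close>; so \<open>m' = m\<close> and hence \<open>v = m\<close>.
  Thus every generating set contains \<open>M\<close>.\<close>

lemma antichain_subset_generators:
  assumes M: "M \<subseteq> monomials n" and N: "N \<subseteq> monomials n"
    and antichain: "\<And>u v. u \<in> M \<Longrightarrow> v \<in> M \<Longrightarrow> mono_dvd u v \<Longrightarrow> u = v"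
    and eq: "(mono_gen_ideal n N :: 'k::field mpoly set) = mono_gen_ideal n M"
  shows "M \<subseteq> N"
proof
  fix m assume m: "m \<in> M"
  then obtain v where v: "v \<in> N" "mono_dvd v m"
    using mono_gen_ideal_divisible[OF N] mono_poly_in_mono_gen_ideal[OF M m] eq by metis
  then obtain m' where m': "m' \<in> M" "mono_dvd m' v"
    using mono_gen_ideal_divisible[OF M] mono_poly_in_mono_gen_ideal[OF N v(1)] eq by metis
  from m' v m have "m' = m"
    using antichain mono_dvd_trans by blast
  with m' v show "m \<in> N"
    using mono_dvd_antisym by blast
qed

lemma min_gens_antichain:
  assumes "M \<subseteq> monomials n"
    and "\<And>u v. u \<in> M \<Longrightarrow> v \<in> M \<Longrightarrow> mono_dvd u v \<Longrightarrow> u = v"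
  shows "min_gens n (mono_gen_ideal n M :: 'k::field mpoly set) = M"
proof -
  let ?I = "mono_gen_ideal n M :: 'k mpoly set"
  have contains: "M \<subseteq> N" if "N \<subseteq> monomials n" "mono_gen_ideal n N = ?I" for N
    using antichain_subset_generators[OF assms(1) that(1) assms(2) that(2)] .
  show ?thesis
    unfolding min_gens_def
  proof (rule the_equality)
    show "is_min_gens n ?I M"
      using assms(1) contains unfolding is_min_gens_def by blast
  next
    fix N assume "is_min_gens n ?I N"
    then show "N = M"
      using contains unfolding is_min_gens_def by blast
  qed
qed

section \<open>Squarefree monomials and basis exchange\<close>

definition squarefree_mono :: "nat set \<Rightarrow> mono"
  where "squarefree_mono X = (\<Sum>k\<in>X. Poly_Mapping.single k 1)"

text \<open>The bases of a matroid are the members of a nonempty family with this property; here the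
  empty family is admitted.\<close>

definition basis_exchange :: "'a set set \<Rightarrow> bool"
  where "basis_exchange B \<longleftrightarrow>
    (\<forall>X\<in>B. \<forall>Y\<in>B. \<forall>i\<in>X - Y. \<exists>j\<in>Y - X. insert j (X - {i}) \<in> B)"

lemma lookup_squarefree_mono:
  "finite X \<Longrightarrow> Poly_Mapping.lookup (squarefree_mono X) k = (if k \<in> X then 1 else 0)"
  by (simp add: squarefree_mono_def lookup_sum lookup_single when_def)

lemma keys_squarefree_mono: "finite X \<Longrightarrow> Poly_Mapping.keys (squarefree_mono X) = X"
  by (auto simp: in_keys_iff lookup_squarefree_mono split: if_splits)

lemma mono_degree_squarefree_mono: "finite X \<Longrightarrow> mono_degree (squarefree_mono X) = card X"
  by (simp add: mono_degree_def keys_squarefree_mono lookup_squarefree_mono)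

lemma mono_dvd_squarefree_monoD:
  assumes "finite X" "finite Y" "mono_dvd (squarefree_mono X) (squarefree_mono Y)"
  shows "X \<subseteq> Y"
proof
  fix k assume "k \<in> X"
  with mono_dvd_lookup_le[OF assms(3), of k] assms show "k \<in> Y"
    by (auto simp: lookup_squarefree_mono split: if_splits)
qed

lemma exchange_squarefree_mono:
  assumes "finite X" "i \<in> X" "j \<notin> X"
  shows "Poly_Mapping.single j 1 + (squarefree_mono X - Poly_Mapping.single i 1)
    = squarefree_mono (insert j (X - {i}))"
  using assms
  by (intro poly_mapping_eqI)
     (auto simp: lookup_add lookup_minus lookup_single lookup_squarefree_mono when_def)

text \<open>Equal cardinalities make the generators an antichain, hence minimal. A comparison of exponents
  0 and 1 is a membership test, which turns the polymatroidal exchange property into basis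
  exchange.\<close>

lemma matroidal_squarefree_iff:
  assumes sub: "\<And>X. X \<in> B \<Longrightarrow> X \<subseteq> {1..n}" and card: "\<And>X. X \<in> B \<Longrightarrow> card X = d"
  shows "matroidal n (mono_gen_ideal n (squarefree_mono ` B) :: 'k::field mpoly set)
    \<longleftrightarrow> basis_exchange B" (is "matroidal n ?I \<longleftrightarrow> _")
proof -
  have fin: "finite X" if "X \<in> B" for X
    using sub[OF that] finite_subset by blast
  have gens: "squarefree_mono ` B \<subseteq> monomials n"
    using sub fin by (fastforce simp: monomials_def keys_squarefree_mono)
  have "u = v" if "u \<in> squarefree_mono ` B" "v \<in> squarefree_mono ` B" "mono_dvd u v" for u v
    using that mono_dvd_squarefree_monoD fin card by (metis card_subset_eq imageE)
  with gens have min: "min_gens n ?I = squarefree_mono ` B"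
    by (rule min_gens_antichain)
  have monomial: "monomial_ideal n ?I"
    using gens unfolding monomial_ideal_def by blast
  have squarefree: "squarefree_ideal n ?I"
    using monomial fin by (auto simp: squarefree_ideal_def min deg_var_eq_lookup lookup_squarefree_mono)
  have degree: "\<forall>u\<in>squarefree_mono ` B. \<forall>v\<in>squarefree_mono ` B. mono_degree u = mono_degree v"
    using fin card by (auto simp: mono_degree_squarefree_mono)
  have deg: "deg_var i (squarefree_mono Y) < deg_var i (squarefree_mono X) \<longleftrightarrow> i \<in> X - Y"
    if "X \<in> B" "Y \<in> B" for X Y i
    using that fin by (auto simp: deg_var_eq_lookup lookup_squarefree_mono)
  \<comment> \<open>Supports determine squarefree monomials, so membership can be tested on supports.\<close>
  have mem: "squarefree_mono Z \<in> squarefree_mono ` B \<longleftrightarrow> Z \<in> B" if "finite Z" for Z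
    using that fin keys_squarefree_mono by (metis image_iff)
  have exchange: "Poly_Mapping.single j 1 + (squarefree_mono X - Poly_Mapping.single i 1)
      \<in> squarefree_mono ` B \<longleftrightarrow> insert j (X - {i}) \<in> B"
    if "X \<in> B" "i \<in> X" "j \<notin> X" for X i j
    using exchange_squarefree_mono[OF fin[OF that(1)] that(2,3)] mem fin[OF that(1)] by simp
  have step: "(\<forall>i\<in>{1..n}. deg_var i (squarefree_mono X) > deg_var i (squarefree_mono Y) \<longrightarrow>
        (\<exists>j\<in>{1..n}. deg_var j (squarefree_mono X) < deg_var j (squarefree_mono Y) \<and>
          Poly_Mapping.single j 1 + (squarefree_mono X - Poly_Mapping.single i 1)
            \<in> squarefree_mono ` B)) \<longleftrightarrow>
      (\<forall>i\<in>X - Y. \<exists>j\<in>Y - X. insert j (X - {i}) \<in> B)"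
    if "X \<in> B" "Y \<in> B" for X Y
    unfolding deg[OF that] deg[OF that(2,1)]
    using sub[OF that(1)] sub[OF that(2)] exchange[OF that(1)] by (meson DiffD1 DiffD2 subsetD)
  have "matroidal n ?I \<longleftrightarrow> (\<forall>X\<in>B. \<forall>Y\<in>B.
      \<forall>i\<in>{1..n}. deg_var i (squarefree_mono X) > deg_var i (squarefree_mono Y) \<longrightarrow>
        (\<exists>j\<in>{1..n}. deg_var j (squarefree_mono X) < deg_var j (squarefree_mono Y) \<and>
          Poly_Mapping.single j 1 + (squarefree_mono X - Poly_Mapping.single i 1)
            \<in> squarefree_mono ` B))"
    using squarefree monomial degree
    unfolding matroidal_def polymatroidal_def min ball_simps(9) by blast
  also have "\<dots> \<longleftrightarrow> basis_exchange B"
    unfolding basis_exchange_def by (intro ball_cong[OF refl] step)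
  finally show ?thesis .
qed

section \<open>Transitivity of non-adjacency\<close>

definition transitive_nonadjacency :: "'a set \<Rightarrow> 'a set set \<Rightarrow> bool"
  where "transitive_nonadjacency V E \<longleftrightarrow>
    (\<forall>a\<in>V. \<forall>b\<in>V. \<forall>c\<in>V. {b, c} \<in> E \<longrightarrow> a \<noteq> b \<longrightarrow> a \<noteq> c \<longrightarrow> {a, b} \<in> E \<or> {a, c} \<in> E)"

lemma pair_in_nsets_2: "{a, b} \<in> [V]\<^bsup>2\<^esup> \<longleftrightarrow> a \<in> V \<and> b \<in> V \<and> a \<noteq> b"
  by (auto simp: nsets_def card_insert_if)

lemma nsets_2_cases:
  assumes "e \<in> [V]\<^bsup>2\<^esup>" "a \<in> e"
  obtains b where "e = {a, b}" "a \<noteq> b" "a \<in> V" "b \<in> V"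
proof -
  obtain x y where "e = {x, y}" "x \<noteq> y" "x \<in> V" "y \<in> V"
    using assms(1) by (auto simp: nsets_def card_2_iff)
  with assms(2) that[of x] that[of y] show thesis
    by (auto simp: insert_commute)
qed

lemma edge_pairE:
  assumes "simple_graph V E" "e \<in> E"
  obtains a b where "e = {a, b}" "a \<noteq> b" "a \<in> V" "b \<in> V"
proof -
  have "e \<in> [V]\<^bsup>2\<^esup>" using assms by (auto simp: simple_graph_def)
  with that show thesis by (auto simp: nsets_def card_2_iff)
qed

lemma edge_ends:
  assumes "simple_graph V E" "{a, b} \<in> E"
  shows "a \<in> V" "b \<in> V" "a \<noteq> b"
  using assms unfolding simple_graph_def by (meson pair_in_nsets_2 subsetD)+

lemma edge_doubletonE:
  assumes "simple_graph V E" "e \<in> E" "a \<in> e"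
  obtains b where "e = {a, b}" "a \<noteq> b" "a \<in> V" "b \<in> V"
  using assms nsets_2_cases by (metis simple_graph_def subsetD)

lemma basis_exchange_edges_iff:
  assumes G: "simple_graph V E" and iso: "no_isolated V E"
  shows "basis_exchange E \<longleftrightarrow> transitive_nonadjacency V E"
proof
  assume ex: "basis_exchange E"
  show "transitive_nonadjacency V E"
    unfolding transitive_nonadjacency_def
  proof (intro ballI impI)
    fix a b c assume *: "a \<in> V" "b \<in> V" "c \<in> V" "{b, c} \<in> E" "a \<noteq> b" "a \<noteq> c"
    \<comment> \<open>Exchanging \<open>i\<close> in \<open>{a, i}\<close> against an end of \<open>{b, c}\<close> keeps \<open>a\<close>.\<close>
    obtain i where i: "{a, i} \<in> E" "a \<noteq> i"
      using iso *(1) edge_doubletonE[OF G] unfolding no_isolated_def by metis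
    show "{a, b} \<in> E \<or> {a, c} \<in> E"
    proof (cases "i \<in> {b, c}")
      case True
      then show ?thesis using i by auto
    next
      case False
      with i * obtain j where "j \<in> {b, c}" "insert j ({a, i} - {i}) \<in> E"
        using ex unfolding basis_exchange_def by (metis DiffD1 DiffI insertCI)
      moreover have "{a, i} - {i} = {a}" using i by auto
      ultimately show ?thesis by (auto simp: insert_commute)
    qed
  qed
next
  assume tr: "transitive_nonadjacency V E"
  show "basis_exchange E"
    unfolding basis_exchange_def
  proof (intro ballI)
    fix e f i assume e: "e \<in> E" and f: "f \<in> E" and i: "i \<in> e - f"
    obtain a where a: "e = {i, a}" "i \<noteq> a" "a \<in> V"
      using edge_doubletonE[OF G e] i by (metis DiffD1)
    have diff: "e - {i} = {a}" using a by auto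
    show "\<exists>j\<in>f - e. insert j (e - {i}) \<in> E"
    proof (cases "a \<in> f")
      case True
      then obtain c where "f = {a, c}" "a \<noteq> c"
        using edge_doubletonE[OF G f] by metis
      then show ?thesis
        using f i a diff by (intro bexI[of _ c]) (auto simp: insert_commute)
    next
      case False
      obtain b c where bc: "f = {b, c}" "b \<in> V" "c \<in> V"
        using edge_pairE[OF G f] by metis
      with False f a tr have "{a, b} \<in> E \<or> {a, c} \<in> E"
        unfolding transitive_nonadjacency_def by auto
      then show ?thesis
        using bc False i a diff by (auto simp: insert_commute)
    qed
  qed
qed

text \<open>Passing to complements turns the exchange axiom into its dual: here the element
  \<open>i \<in> f - e\<close> that has to enter \<open>e\<close> is prescribed, and the element \<open>j\<close> that leaves \<open>e\<close>
  may be chosen.\<close>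

lemma basis_exchange_compl_iff:
  assumes "\<And>X. X \<in> B \<Longrightarrow> X \<subseteq> V"
  shows "basis_exchange ((-) V ` B) \<longleftrightarrow>
    (\<forall>e\<in>B. \<forall>f\<in>B. \<forall>i\<in>f - e. \<exists>j\<in>e - f. insert i (e - {j}) \<in> B)"
proof -
  have diff: "(V - e) - (V - f) = f - e" if "e \<in> B" "f \<in> B" for e f
    using assms that by blast
  have "insert j ((V - e) - {i}) \<in> (-) V ` B \<longleftrightarrow> insert i (e - {j}) \<in> B"
    if "e \<in> B" "f \<in> B" "i \<in> f - e" "j \<in> e - f" for e f i j
  proof -
    have eq: "insert j ((V - e) - {i}) = V - insert i (e - {j})"
      and sub: "insert i (e - {j}) \<subseteq> V"
      using assms[OF that(1)] assms[OF that(2)] that(3,4) by blast+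
    have "W = X" if "X \<in> B" "V - insert i (e - {j}) = V - X" "W = insert i (e - {j})" for W X
      using that sub assms[OF that(1)] by (metis double_diff subset_refl)
    then show ?thesis
      unfolding eq by blast
  qed
  then show ?thesis
    unfolding basis_exchange_def using diff by simp
qed

lemma basis_exchange_compl_edges_iff:
  assumes G: "simple_graph V E" and iso: "no_isolated V E"
  shows "basis_exchange ((-) V ` E) \<longleftrightarrow> transitive_nonadjacency V E"
proof -
  have "X \<subseteq> V" if "X \<in> E" for X
    using G that by (auto simp: simple_graph_def nsets_def)
  then have dual: "basis_exchange ((-) V ` E) \<longleftrightarrow>
      (\<forall>e\<in>E. \<forall>f\<in>E. \<forall>i\<in>f - e. \<exists>j\<in>e - f. insert i (e - {j}) \<in> E)"
    by (rule basis_exchange_compl_iff)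
  show ?thesis
    unfolding dual
  proof
    assume ex: "\<forall>e\<in>E. \<forall>f\<in>E. \<forall>i\<in>f - e. \<exists>j\<in>e - f. insert i (e - {j}) \<in> E"
    show "transitive_nonadjacency V E"
      unfolding transitive_nonadjacency_def
    proof (intro ballI impI)
      fix a b c assume *: "a \<in> V" "b \<in> V" "c \<in> V" "{b, c} \<in> E" "a \<noteq> b" "a \<noteq> c"
      obtain i where i: "{a, i} \<in> E"
        using iso *(1) edge_doubletonE[OF G] unfolding no_isolated_def by metis
      \<comment> \<open>Letting \<open>a\<close> enter \<open>{b, c}\<close> leaves an edge from \<open>a\<close> to the remaining end.\<close>
      have "a \<in> {a, i} - {b, c}" using * by auto
      with i * ex obtain j where j: "j \<in> {b, c}" "insert a ({b, c} - {j}) \<in> E"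
        by (meson DiffD1)
      have "b \<noteq> c"
        using edge_ends[OF G *(4)] by simp
      then have "{b, c} - {b} = {c}" "{b, c} - {c} = {b}" by auto
      with j show "{a, b} \<in> E \<or> {a, c} \<in> E" by (metis insertE singletonD)
    qed
  next
    assume tr: "transitive_nonadjacency V E"
    show "\<forall>e\<in>E. \<forall>f\<in>E. \<forall>i\<in>f - e. \<exists>j\<in>e - f. insert i (e - {j}) \<in> E"
    proof (intro ballI)
      fix e f a assume e: "e \<in> E" and f: "f \<in> E" and a: "a \<in> f - e"
      obtain d where d: "f = {a, d}" "a \<noteq> d" "a \<in> V"
        using edge_doubletonE[OF G f] a by (metis DiffD1)
      show "\<exists>j\<in>e - f. insert a (e - {j}) \<in> E"
      proof (cases "d \<in> e")
        case True
        then obtain c where c: "e = {d, c}" "d \<noteq> c"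
          using edge_doubletonE[OF G e] by metis
        then have "insert a (e - {c}) = f" using d by auto
        then show ?thesis using c d f a by (intro bexI[of _ c]) auto
      next
        case False
        obtain b c where bc: "e = {b, c}" "b \<noteq> c" "b \<in> V" "c \<in> V"
          using edge_pairE[OF G e] by metis
        then have "e - {c} = {b}" "e - {b} = {c}" by auto
        moreover from bc a d e tr have "{a, b} \<in> E \<or> {a, c} \<in> E"
          unfolding transitive_nonadjacency_def by auto
        ultimately have "\<exists>j\<in>e. insert a (e - {j}) \<in> E"
          using bc(1) by (metis insertCI)
        moreover have "e - f = e"
          using False a d(1) by blast
        ultimately show ?thesis by simp
      qed
    qed
  qed
qed

section \<open>The complementary graph\<close>

lemma simple_graph_compl_edges: "finite V \<Longrightarrow> simple_graph V (compl_edges V E)"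
  by (auto simp: simple_graph_def compl_edges_def)

lemma pair_in_compl_edges:
  "{a, b} \<in> compl_edges V E \<longleftrightarrow> a \<in> V \<and> b \<in> V \<and> a \<noteq> b \<and> {a, b} \<notin> E"
  by (auto simp: compl_edges_def pair_in_nsets_2)

text \<open>A triple \<open>a, b, c\<close> that violates the right-hand side is an induced path with middle
  vertex \<open>b\<close>.\<close>

lemma P3_free_iff:
  assumes G: "simple_graph V E"
  shows "P3_free V E \<longleftrightarrow>
    (\<forall>a b c. {a, b} \<in> E \<longrightarrow> {b, c} \<in> E \<longrightarrow> a \<noteq> c \<longrightarrow> {a, c} \<in> E)"
proof
  assume free: "P3_free V E"
  show "\<forall>a b c. {a, b} \<in> E \<longrightarrow> {b, c} \<in> E \<longrightarrow> a \<noteq> c \<longrightarrow> {a, c} \<in> E"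
  proof (intro allI impI, rule ccontr)
    fix a b c assume *: "{a, b} \<in> E" "{b, c} \<in> E" "a \<noteq> c" "{a, c} \<notin> E"
    then have sym: "{b, a} \<in> E" "{c, b} \<in> E" by (simp_all add: insert_commute)
    have V: "a \<in> V" "b \<in> V" "c \<in> V" "a \<noteq> b" "b \<noteq> c"
      using edge_ends[OF G *(1)] edge_ends[OF G *(2)] by simp_all
    define f where "f = (\<lambda>k::nat. if k = 1 then a else if k = 2 then b else c)"
    have "bij_betw f P3_verts {a, b, c}"
      using V * by (auto simp: bij_betw_def inj_on_def P3_verts_def f_def)
    moreover have "induced_edges E {a, b, c} = (\<lambda>e. f ` e) ` P3_edges"
    proof
      show "(\<lambda>e. f ` e) ` P3_edges \<subseteq> induced_edges E {a, b, c}"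
        using * sym by (auto simp: P3_edges_def f_def induced_edges_def)
      show "induced_edges E {a, b, c} \<subseteq> (\<lambda>e. f ` e) ` P3_edges"
      proof
        fix e assume "e \<in> induced_edges E {a, b, c}"
        then have e: "e \<in> E" "e \<subseteq> {a, b, c}" by (auto simp: induced_edges_def)
        obtain x y where xy: "e = {x, y}" "x \<noteq> y"
          using edge_pairE[OF G e(1)] by metis
        with e * have "e = {a, b} \<or> e = {b, c}"
          by (auto simp: insert_commute)
        then show "e \<in> (\<lambda>e. f ` e) ` P3_edges"
          by (auto simp: P3_edges_def f_def)
      qed
    qed
    ultimately show False
      using free V unfolding P3_free_def graph_isomorphic_def
      by (metis empty_subsetI insert_subset)
  qed
next
  assume closed: "\<forall>a b c. {a, b} \<in> E \<longrightarrow> {b, c} \<in> E \<longrightarrow> a \<noteq> c \<longrightarrow> {a, c} \<in> E"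
  show "P3_free V E"
    unfolding P3_free_def
  proof
    assume "\<exists>W\<subseteq>V. graph_isomorphic P3_verts P3_edges W (induced_edges E W)"
    then obtain W f where f: "bij_betw f P3_verts W"
      and edges: "induced_edges E W = (\<lambda>e. f ` e) ` P3_edges"
      unfolding graph_isomorphic_def by blast
    from f have W: "f 1 \<in> W" "f 2 \<in> W" "f 3 \<in> W"
      and ne: "f 1 \<noteq> f 2" "f 2 \<noteq> f 3" "f 1 \<noteq> f 3"
      by (auto simp: bij_betw_def inj_on_def P3_verts_def)
    from edges have img: "induced_edges E W = {{f 1, f 2}, {f 2, f 3}}"
      by (simp add: P3_edges_def)
    then have "{f 1, f 2} \<in> E" "{f 2, f 3} \<in> E"
      by (auto simp: induced_edges_def)
    with closed ne have "{f 1, f 3} \<in> E" by blast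
    with W have "{f 1, f 3} \<in> induced_edges E W"
      by (auto simp: induced_edges_def)
    with img ne show False
      by (auto simp: doubleton_eq_iff)
  qed
qed

lemma transitive_nonadjacency_iff_P3_free:
  assumes "simple_graph V E"
  shows "transitive_nonadjacency V E \<longleftrightarrow> P3_free V (compl_edges V E)"
proof -
  have "finite V" using assms by (simp add: simple_graph_def)
  show ?thesis
    unfolding P3_free_iff[OF simple_graph_compl_edges[OF \<open>finite V\<close>]]
      pair_in_compl_edges transitive_nonadjacency_def
  proof (intro iffI allI impI ballI)
    fix a b c
    assume tr: "\<forall>a\<in>V. \<forall>b\<in>V. \<forall>c\<in>V. {b, c} \<in> E \<longrightarrow> a \<noteq> b \<longrightarrow> a \<noteq> c \<longrightarrow> {a, b} \<in> E \<or> {a, c} \<in> E"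
      and ab: "a \<in> V \<and> b \<in> V \<and> a \<noteq> b \<and> {a, b} \<notin> E"
      and bc: "b \<in> V \<and> c \<in> V \<and> b \<noteq> c \<and> {b, c} \<notin> E" and "a \<noteq> c"
    from ab have "{b, a} \<notin> E" by (simp add: insert_commute)
    then have "{a, c} \<notin> E" using tr[rule_format, of b a c] ab bc by blast
    then show "a \<in> V \<and> c \<in> V \<and> a \<noteq> c \<and> {a, c} \<notin> E"
      using ab bc \<open>a \<noteq> c\<close> by blast
  next
    fix a b c
    assume closed: "\<forall>a b c. a \<in> V \<and> b \<in> V \<and> a \<noteq> b \<and> {a, b} \<notin> E \<longrightarrow>
        b \<in> V \<and> c \<in> V \<and> b \<noteq> c \<and> {b, c} \<notin> E \<longrightarrow> a \<noteq> c \<longrightarrow>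
        a \<in> V \<and> c \<in> V \<and> a \<noteq> c \<and> {a, c} \<notin> E"
      and *: "a \<in> V" "b \<in> V" "c \<in> V" "{b, c} \<in> E" "a \<noteq> b" "a \<noteq> c"
    have "{b, a} \<in> E \<or> {a, c} \<in> E"
      using closed[rule_format, of b a c] * edge_ends(3)[OF assms *(4)] by blast
    then show "{a, b} \<in> E \<or> {a, c} \<in> E" by (simp add: insert_commute)
  qed
qed

text \<open>If no induced path exists, the closed neighbourhoods are the classes of an equivalence
  relation.\<close>

lemma P3_free_iff_disjoint_union_of_cliques:
  assumes G: "simple_graph V E"
  shows "P3_free V E \<longleftrightarrow> disjoint_union_of_cliques V E"
proof
  assume "P3_free V E"
  then have closed: "{a, c} \<in> E" if "{a, b} \<in> E" "{b, c} \<in> E" "a \<noteq> c" for a b c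
    using that by (simp add: P3_free_iff[OF G])
  define r where "r = {(a, b). a \<in> V \<and> b \<in> V \<and> (a = b \<or> {a, b} \<in> E)}"
  have "equiv V r"
  proof (rule equivI)
    show "r \<subseteq> V \<times> V" by (auto simp: r_def)
    show "refl_on V r" by (auto simp: refl_on_def r_def)
    show "sym r" by (auto simp: sym_def r_def insert_commute)
    show "trans r" using closed by (auto simp: trans_def r_def)
  qed
  then have "partition_on V (V // r)" by (rule partition_on_quotient)
  moreover have "E = (\<Union>A\<in>V // r. [A]\<^bsup>2\<^esup>)"
  proof
    show "E \<subseteq> (\<Union>A\<in>V // r. [A]\<^bsup>2\<^esup>)"
    proof
      fix e assume "e \<in> E"
      then obtain a b where ab: "e = {a, b}" "a \<noteq> b" "a \<in> V" "b \<in> V" "{a, b} \<in> E"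
        using edge_pairE[OF G] by metis
      then have "a \<in> r `` {a}" "b \<in> r `` {a}"
        by (simp_all add: r_def)
      then have "e \<in> [r `` {a}]\<^bsup>2\<^esup>"
        unfolding ab(1) pair_in_nsets_2 using ab(2) by blast
      moreover have "r `` {a} \<in> V // r"
        using ab(3) by (rule quotientI)
      ultimately show "e \<in> (\<Union>A\<in>V // r. [A]\<^bsup>2\<^esup>)" by blast
    qed
    show "(\<Union>A\<in>V // r. [A]\<^bsup>2\<^esup>) \<subseteq> E"
    proof
      fix e assume "e \<in> (\<Union>A\<in>V // r. [A]\<^bsup>2\<^esup>)"
      then obtain A a b where A: "A \<in> V // r" and e: "e = {a, b}" "a \<noteq> b" "a \<in> A" "b \<in> A"
        by (auto simp: nsets_def card_2_iff)
      from quotient_eq_iff[OF \<open>equiv V r\<close> A A e(3,4)] e(2) show "e \<in> E"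
        by (auto simp: r_def e(1))
    qed
  qed
  ultimately show "disjoint_union_of_cliques V E"
    unfolding disjoint_union_of_cliques_def by blast
next
  assume "disjoint_union_of_cliques V E"
  then obtain P where P: "partition_on V P" and E: "E = (\<Union>A\<in>P. [A]\<^bsup>2\<^esup>)"
    unfolding disjoint_union_of_cliques_def by blast
  have "{a, c} \<in> E" if ab: "{a, b} \<in> E" and bc: "{b, c} \<in> E" and "a \<noteq> c" for a b c
  proof -
    from ab obtain A where A: "A \<in> P" "a \<in> A" "b \<in> A"
      by (auto simp: E pair_in_nsets_2)
    from bc obtain B where B: "B \<in> P" "b \<in> B" "c \<in> B"
      by (auto simp: E pair_in_nsets_2)
    from A B have "A = B"
      using partition_onD2[OF P] by (auto simp: disjoint_def)
    with A B \<open>a \<noteq> c\<close> show ?thesis by (auto simp: E pair_in_nsets_2)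
  qed
  then show "P3_free V E" by (simp add: P3_free_iff[OF G])
qed

lemma pairs_not_inside_classes:
  assumes V: "V = (\<Union>i\<in>I. A i)" and disj: "disjoint_family_on A I"
  shows "[V]\<^bsup>2\<^esup> - (\<Union>i\<in>I. [A i]\<^bsup>2\<^esup>)
    = {{r, s} | r s i j. i \<in> I \<and> j \<in> I \<and> i \<noteq> j \<and> r \<in> A i \<and> s \<in> A j}" (is "?L = ?R")
proof
  show "?L \<subseteq> ?R"
  proof
    fix e assume e: "e \<in> ?L"
    then obtain r s where rs: "e = {r, s}" "r \<noteq> s" "r \<in> V" "s \<in> V"
      by (auto simp: nsets_def card_2_iff)
    then obtain i j where ij: "i \<in> I" "j \<in> I" "r \<in> A i" "s \<in> A j"
      using V by auto
    with e rs have "i \<noteq> j" by (auto simp: pair_in_nsets_2)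
    with rs ij show "e \<in> ?R" by blast
  qed
  show "?R \<subseteq> ?L"
  proof
    fix e assume "e \<in> ?R"
    then obtain r s i j where *: "e = {r, s}" "i \<in> I" "j \<in> I" "i \<noteq> j" "r \<in> A i" "s \<in> A j"
      by blast
    have unique: "k = l" if "k \<in> I" "l \<in> I" "x \<in> A k" "x \<in> A l" for k l x
      using disj that unfolding disjoint_family_on_def by blast
    have "r \<noteq> s" using unique * by blast
    moreover have "r \<in> V" "s \<in> V" using V * by auto
    moreover have "\<not> (r \<in> A k \<and> s \<in> A k)" if "k \<in> I" for k
      using unique * that by metis
    ultimately show "e \<in> ?L" using *(1) by (auto simp: pair_in_nsets_2)
  qed
qed

text \<open>The existence of an edge forces at least two parts.\<close>

lemma disjoint_union_of_cliques_compl_iff: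
  assumes G: "simple_graph V E" and "E \<noteq> {}"
  shows "disjoint_union_of_cliques V (compl_edges V E) \<longleftrightarrow> complete_multipartite V E"
proof
  have E: "E \<subseteq> [V]\<^bsup>2\<^esup>" and "finite V" using G by (auto simp: simple_graph_def)
  assume "disjoint_union_of_cliques V (compl_edges V E)"
  then obtain P where P: "partition_on V P" and cliques: "compl_edges V E = (\<Union>A\<in>P. [A]\<^bsup>2\<^esup>)"
    unfolding disjoint_union_of_cliques_def by blast
  have "finite P" using P \<open>finite V\<close> by (rule finite_elements[rotated])
  define m where "m = card P"
  obtain A where A: "bij_betw A {1..m} P"
    using ex_bij_betw_nat_finite_1[OF \<open>finite P\<close>] m_def by blast
  have V: "V = (\<Union>i\<in>{1..m}. A i)"
    using partition_onD1[OF P] A by (auto simp: bij_betw_def)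
  have disj: "disjoint_family_on A {1..m}"
    using partition_onD2[OF P] A
    by (metis bij_betw_def disjoint_image_disjoint_family_on)
  have ne: "\<forall>i\<in>{1..m}. A i \<noteq> {}"
    using partition_onD3[OF P] A by (auto simp: bij_betw_def)
  have union: "(\<Union>A\<in>P. [A]\<^bsup>2\<^esup>) = (\<Union>i\<in>{1..m}. [A i]\<^bsup>2\<^esup>)"
    using A by (auto simp: bij_betw_def)
  have "E = [V]\<^bsup>2\<^esup> - (\<Union>i\<in>{1..m}. [A i]\<^bsup>2\<^esup>)"
    using double_diff[OF E subset_refl] cliques unfolding union compl_edges_def by simp
  then have edges: "E = {{r, s} | r s i j. i \<in> {1..m} \<and> j \<in> {1..m} \<and> i \<noteq> j \<and> r \<in> A i \<and> s \<in> A j}"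
    by (simp only: pairs_not_inside_classes[OF V disj])
  then obtain i j where "i \<in> {1..m}" "j \<in> {1..m}" "i \<noteq> j"
    using \<open>E \<noteq> {}\<close> by blast
  then have "m \<ge> 2" by auto
  then show "complete_multipartite V E"
    unfolding complete_multipartite_def using V disj ne edges by blast
next
  assume "complete_multipartite V E"
  then obtain m :: nat and A where V: "V = (\<Union>i\<in>{1..m}. A i)"
    and disj: "disjoint_family_on A {1..m}" and ne: "\<forall>i\<in>{1..m}. A i \<noteq> {}"
    and edges: "E = {{r, s} | r s i j. i \<in> {1..m} \<and> j \<in> {1..m} \<and> i \<noteq> j \<and> r \<in> A i \<and> s \<in> A j}"
    unfolding complete_multipartite_def by blast
  have "partition_on V (A ` {1..m})"
  proof (rule partition_onI)
    show "\<Union> (A ` {1..m}) = V" by (simp add: V)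
    show "disjnt B C" if "B \<in> A ` {1..m}" "C \<in> A ` {1..m}" "B \<noteq> C" for B C
      using disjointD[OF disjoint_family_on_disjoint_image[OF disj] that]
      by (simp add: disjnt_def)
    show "{} \<notin> A ` {1..m}" using ne by auto
  qed
  moreover have E: "E = [V]\<^bsup>2\<^esup> - (\<Union>i\<in>{1..m}. [A i]\<^bsup>2\<^esup>)"
    using edges by (simp only: pairs_not_inside_classes[OF V disj])
  have "(\<Union>i\<in>{1..m}. [A i]\<^bsup>2\<^esup>) \<subseteq> [V]\<^bsup>2\<^esup>"
    unfolding V by (intro UN_least nsets_mono UN_upper)
  then have "compl_edges V E = (\<Union>B\<in>A ` {1..m}. [B]\<^bsup>2\<^esup>)"
    unfolding compl_edges_def E by (simp add: double_diff)
  ultimately show "disjoint_union_of_cliques V (compl_edges V E)"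
    unfolding disjoint_union_of_cliques_def by blast
qed

section \<open>Edge ideals and complementary edge ideals\<close>

lemma squarefree_mono_doubleton:
  "i \<noteq> j \<Longrightarrow> squarefree_mono {i, j} = Poly_Mapping.single i 1 + Poly_Mapping.single j 1"
  by (simp add: squarefree_mono_def)

lemma squarefree_mono_Diff:
  assumes "finite V" "X \<subseteq> V"
  shows "squarefree_mono (V - X) = squarefree_mono V - squarefree_mono X"
  using assms finite_subset[OF assms(2,1)]
  by (intro poly_mapping_eqI) (auto simp: lookup_minus lookup_squarefree_mono)

text \<open>Generators indexed by ordered pairs of adjacent vertices are generators indexed by edges.\<close>

lemma edges_image:
  assumes "simple_graph V E" "\<And>i j. i \<noteq> j \<Longrightarrow> {i, j} \<in> E \<Longrightarrow> g {i, j} = h i j"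
  shows "{h i j | i j. {i, j} \<in> E} = g ` E"
proof -
  show ?thesis
  proof
    show "{h i j | i j. {i, j} \<in> E} \<subseteq> g ` E"
    proof
      fix u assume "u \<in> {h i j | i j. {i, j} \<in> E}"
      then obtain i j where ij: "u = h i j" "{i, j} \<in> E" by blast
      then have "u = g {i, j}"
        using assms(2) edge_ends(3)[OF assms(1)] by metis
      with ij(2) show "u \<in> g ` E" by blast
    qed
    show "g ` E \<subseteq> {h i j | i j. {i, j} \<in> E}"
    proof
      fix u assume "u \<in> g ` E"
      then obtain e where "e \<in> E" "u = g e" by blast
      moreover from this obtain i j where "e = {i, j}" "i \<noteq> j"
        using edge_pairE[OF assms(1)] by metis
      ultimately show "u \<in> {h i j | i j. {i, j} \<in> E}"
        using assms(2) by blast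
    qed
  qed
qed

lemma edge_ideal_eq:
  assumes "simple_graph {1..n} E"
  shows "edge_ideal n E = mono_gen_ideal n (squarefree_mono ` E)"
  unfolding edge_ideal_def
  by (subst edges_image[OF assms, of squarefree_mono]) (simp_all add: squarefree_mono_doubleton)

lemma compl_edge_ideal_eq:
  assumes "simple_graph {1..n} E"
  shows "compl_edge_ideal n E = mono_gen_ideal n (squarefree_mono ` (-) {1..n} ` E)"
proof -
  have "squarefree_mono ({1..n} - {i, j}) =
      (\<Sum>k\<in>{1..n}. Poly_Mapping.single k 1) - (Poly_Mapping.single i 1 + Poly_Mapping.single j 1)"
    if "i \<noteq> j" "{i, j} \<in> E" for i j
  proof -
    have "{i, j} \<subseteq> {1..n}"
      using assms that by (auto simp: simple_graph_def nsets_def)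
    then show ?thesis
      using squarefree_mono_Diff[of "{1..n}" "{i, j}"] squarefree_mono_doubleton[OF that(1)]
      by (simp add: squarefree_mono_def[of "{Suc 0..n}"])
  qed
  then show ?thesis
    unfolding compl_edge_ideal_def image_image
    by (subst edges_image[OF assms, of "\<lambda>e. squarefree_mono ({1..n} - e)"]) simp_all
qed

theorem theorem3p1:
  fixes n :: nat and E :: "nat set set"
  assumes "n \<ge> 1"
    and "simple_graph {1..n} E"
    and "no_isolated {1..n} E"
  shows "(matroidal n (edge_ideal n E :: 'k::field mpoly set) \<longleftrightarrow>
           matroidal n (compl_edge_ideal n E :: 'k mpoly set)) \<and>
         (matroidal n (compl_edge_ideal n E :: 'k mpoly set) \<longleftrightarrow>
           P3_free {1..n} (compl_edges {1..n} E)) \<and>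
         (P3_free {1..n} (compl_edges {1..n} E) \<longleftrightarrow>
           disjoint_union_of_cliques {1..n} (compl_edges {1..n} E)) \<and>
         (disjoint_union_of_cliques {1..n} (compl_edges {1..n} E) \<longleftrightarrow>
           complete_multipartite {1..n} E)"
proof -
  let ?V = "{1..n}"
  have edge: "e \<subseteq> ?V" "card e = 2" if "e \<in> E" for e
    using assms(2) that by (auto simp: simple_graph_def nsets_def)
  have "matroidal n (edge_ideal n E :: 'k mpoly set) \<longleftrightarrow> transitive_nonadjacency ?V E"
    unfolding edge_ideal_eq[OF assms(2)]
    using matroidal_squarefree_iff[of E n 2] edge basis_exchange_edges_iff[OF assms(2,3)] by simp
  moreover have "X \<subseteq> ?V" "card X = n - 2" if "X \<in> (-) ?V ` E" for X
    using that edge by (auto simp: card_Diff_subset finite_subset[OF edge(1)])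
  then have "matroidal n (compl_edge_ideal n E :: 'k mpoly set) \<longleftrightarrow> transitive_nonadjacency ?V E"
    unfolding compl_edge_ideal_eq[OF assms(2)] basis_exchange_compl_edges_iff[OF assms(2,3), symmetric]
    by (rule matroidal_squarefree_iff)
  moreover note transitive_nonadjacency_iff_P3_free[OF assms(2)]
  moreover have "P3_free ?V (compl_edges ?V E) \<longleftrightarrow>
      disjoint_union_of_cliques ?V (compl_edges ?V E)"
    by (intro P3_free_iff_disjoint_union_of_cliques simple_graph_compl_edges) simp
  moreover have "E \<noteq> {}"
    using assms(1,3) by (auto simp: no_isolated_def)
  then have "disjoint_union_of_cliques ?V (compl_edges ?V E) \<longleftrightarrow> complete_multipartite ?V E"
    by (rule disjoint_union_of_cliques_compl_iff[OF assms(2)])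
  ultimately show ?thesis by simp
qed

end
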